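(* Let $G$ be a connected graph and let $S$ be a simultaneous dominating set of $G$. Then there is a vertex cover $C$ of $G$ with $S\subseteq C$ and $|C\setminus S|\le |S|-1$. In particular, if $C'$ is a vertex cover of $G$ of minimum size and $S'$ is a simultaneous dominating set of $G$ of minimum size, then $|C'|\le 2|S'|-1$.
   Context: All graphs are finite, simple and undirected. For a connected graph $G$, a subset $S\subseteq V(G)$ is a simultaneous dominating set of $G$ if $S$ is a dominating set (every vertex not in $S$ has a neighbour in $S$) in every spanning tree of $G$. *)

theory Defs
  imports "Graph_Theory.Graph_Theory"
begin

text \<open>
  A finite simple undirected graph is a symmetric loop-free digraph without parallel arcs
  (locale \<^locale>\<open>graph\<close>): every edge is a pair of opposite arcs. The constants
  \<^const>\<open>tree\<close> and \<^const>\<open>spanning_tree\<close> of the library exclude directed cycles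
  only. They do not describe undirected trees: an edge, that is a pair of opposite arcs, is a directed
  cycle of length 2, while an acyclically oriented triangle is a \<^const>\<open>tree\<close>. Hence trees are
  defined here among the symmetric graphs, where the undirected cycles are exactly the directed
  cycles of length at least 3.
\<close>

definition undirected_tree :: "('a, 'b) pre_digraph \<Rightarrow> bool" where
  "undirected_tree T \<longleftrightarrow>
     graph T \<and> Digraph_Component.connected T \<and> \<not> (\<exists>p. pre_digraph.cycle T p \<and> 3 \<le> length p)"

definition undirected_spanning_tree :: "('a, 'b) pre_digraph \<Rightarrow> ('a, 'b) pre_digraph \<Rightarrow> bool" where
  "undirected_spanning_tree T G \<longleftrightarrow> undirected_tree T \<and> spanning T G"

definition dominating_set :: "('a, 'b) pre_digraph \<Rightarrow> 'a set \<Rightarrow> bool" where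
  "dominating_set G S \<longleftrightarrow> S \<subseteq> verts G \<and> (\<forall>v \<in> verts G - S. \<exists>u \<in> S. v \<rightarrow>\<^bsub>G\<^esub> u)"

definition simultaneous_dominating_set :: "('a, 'b) pre_digraph \<Rightarrow> 'a set \<Rightarrow> bool" where
  "simultaneous_dominating_set G S \<longleftrightarrow>
     S \<subseteq> verts G \<and> (\<forall>T. undirected_spanning_tree T G \<longrightarrow> dominating_set T S)"

definition vertex_cover :: "('a, 'b) pre_digraph \<Rightarrow> 'a set \<Rightarrow> bool" where
  "vertex_cover G C \<longleftrightarrow> C \<subseteq> verts G \<and> (\<forall>e \<in> arcs G. tail G e \<in> C \<or> head G e \<in> C)"

end

theory Submission
  imports Defs
begin

text \<open>
  If the graph stays connected when all edges between a vertex \<open>v \<notin> S\<close> and \<open>S\<close> are deleted, then \<open>S\<close>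
  does not dominate \<open>v\<close> in a spanning tree of what is left. So for a simultaneous dominating set \<open>S\<close>
  these deletions always disconnect the graph. Fix a root \<open>r \<in> S\<close> and let \<open>Q\<close> be the
  set of all \<open>v \<notin> S\<close> that separate some neighbour \<open>s \<in> S\<close> of \<open>v\<close> from \<open>r\<close>. Such an \<open>s\<close> differs from
  \<open>r\<close> and determines \<open>v\<close>: if \<open>v\<close> and \<open>v'\<close> are both neighbours of \<open>s\<close>, the one that a walk from \<open>r\<close>
  meets first leads to \<open>s\<close> without using the other. Hence \<open>Q\<close> has at most \<open>|S| - 1\<close> elements. If
  \<open>v \<notin> S \<union> Q\<close>, then every neighbour of \<open>v\<close> that is reachable from \<open>r\<close> without using \<open>v\<close> lies in
  \<open>S\<close>; by the same argument on the first vertex met, no edge joins two such vertices, so \<open>S \<union> Q\<close> is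
  a vertex cover.
\<close>

section \<open>Connectivity and deletion of edges\<close>

lemma (in graph) connected_iff_root:
  assumes "r \<in> verts G"
  shows "Digraph_Component.connected G \<longleftrightarrow> (\<forall>v\<in>verts G. (r, v) \<in> (arcs_ends G)\<^sup>*)"
proof -
  \<comment> \<open>Connectedness refers to the symmetric closure, which a symmetric graph equals;
    symmetry of reachability then reduces all pairs to one root.\<close>
  have "(arcs_ends G)\<^sup>s = arcs_ends G"
    using graph_symmetric by (auto simp: symcl_def)
  then have "Digraph_Component.connected G \<longleftrightarrow> strongly_connected G"
    by (simp add: connected_conv strongly_connected_def reachable_def)
  also have "\<dots> \<longleftrightarrow> (\<forall>v\<in>verts G. r \<rightarrow>\<^sup>* v)"
    using assms symmetric_reachable' reachable_trans unfolding strongly_connected_def by blast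
  finally show ?thesis
    using reachable_conv'[OF assms] by simp
qed

text \<open>Deleting by end pairs lets a symmetric \<open>X\<close> remove both arcs of each edge at
  once.\<close>

definition del_ends :: "('a, 'b) pre_digraph \<Rightarrow> ('a \<times> 'a) set \<Rightarrow> ('a, 'b) pre_digraph" where
  "del_ends G X = G\<lparr>arcs := {e \<in> arcs G. (tail G e, head G e) \<notin> X}\<rparr>"

lemma del_ends_simps [simp]:
  "verts (del_ends G X) = verts G"
  "arcs (del_ends G X) = {e \<in> arcs G. (tail G e, head G e) \<notin> X}"
  "tail (del_ends G X) = tail G"
  "head (del_ends G X) = head G"
  by (simp_all add: del_ends_def)

lemma arcs_ends_del_ends [simp]: "arcs_ends (del_ends G X) = arcs_ends G - X"
  by (auto simp: arcs_ends_conv)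

lemma (in graph) graph_del_ends:
  assumes "sym X"
  shows "graph (del_ends G X)"
proof -
  have "symmetric (del_ends G X)"
    using assms graph_symmetric by (auto simp: symmetric_def sym_def)
  then show ?thesis
    by unfold_locales (auto simp: no_loops arc_to_ends_def intro: no_multi_arcs)
qed

section \<open>Spanning subgraphs and spanning trees\<close>

lemma (in graph) spanning_del_ends:
  assumes "sym X"
  shows "spanning (del_ends G X) G"
proof -
  interpret D: graph "del_ends G X" using assms by (rule graph_del_ends)
  show ?thesis
    using wf_digraph D.wf_digraph by (auto simp: spanning_def subgraph_def compatible_def)
qed

lemma spanning_trans:
  assumes "spanning T H" "spanning H G"
  shows "spanning T G"
  using assms by (auto simp: spanning_def subgraph_def compatible_def)

text \<open>The remainder \<open>p\<close> of the cycle is a detour around \<open>e\<close>. In a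
  cycle of length 2 it would be the reverse of \<open>e\<close>, hence the bound on the
  length.\<close>

lemma (in graph) cycle_edge_redundant:
  assumes cyc: "cycle (e # p)" and len: "3 \<le> length (e # p)"
  defines "X \<equiv> {(tail G e, head G e), (head G e, tail G e)}"
  shows "(head G e, tail G e) \<in> (arcs_ends (del_ends G X))\<^sup>*"
proof -
  let ?u = "tail G e" and ?v = "head G e"
  from cyc have walk: "awalk ?v p ?u" and dist: "distinct (awalk_verts ?v p)"
    by (auto simp: cycle_def awalk_Cons_iff)
  from len obtain f f' p' where p: "p = f # f' # p'"
    by (cases p; cases "tl p") auto
  have last: "awlast ?v p = ?u" using walk by auto
  have verts: "awalk_verts ?v p = map (tail G) p @ [?u]"
    using last p by (simp add: awalk_verts_conv)
  have f: "tail G f = ?v" "head G f = tail G f'"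
    using walk p by (auto simp: awalk_Cons_iff)
  \<comment> \<open>Tails along \<open>p\<close> are distinct and differ from \<open>?u\<close>. So
    only \<open>f\<close> leaves \<open>?v\<close>, and it ends at the tail of \<open>f'\<close>,
    not at \<open>?u\<close>.\<close>
  have "(tail G a, head G a) \<notin> X" if "a \<in> set p" for a
  proof -
    have "?u \<notin> tail G ` set p" using dist verts by auto
    then have "tail G a \<noteq> ?u" using that by (metis imageI)
    moreover have "head G a \<noteq> ?u" if "tail G a = ?v"
    proof -
      have "inj_on (tail G) (set p)" using dist verts by (simp add: distinct_map)
      moreover have "f \<in> set p" using p by simp
      ultimately have "a = f" using \<open>a \<in> set p\<close> that f(1) by (simp add: inj_on_def)
      moreover have "?u \<noteq> tail G f'" using \<open>?u \<notin> tail G ` set p\<close> p by simp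
      ultimately show ?thesis using f(2) by simp
    qed
    ultimately show ?thesis by (auto simp: X_def)
  qed
  moreover have "(x, y) \<in> (arcs_ends (del_ends G X))\<^sup>*"
    if "awalk x q y" "\<And>a. a \<in> set q \<Longrightarrow> (tail G a, head G a) \<notin> X" for x q y
    using that
  proof (induction q arbitrary: x)
    case Nil
    then show ?case by (simp add: awalk_Nil_iff)
  next
    case (Cons a q)
    then have "(x, head G a) \<in> arcs_ends (del_ends G X)"
      by (auto simp: awalk_Cons_iff arcs_ends_conv)
    moreover have "(head G a, y) \<in> (arcs_ends (del_ends G X))\<^sup>*"
      using Cons by (auto simp: awalk_Cons_iff)
    ultimately show ?case by (rule converse_rtrancl_into_rtrancl)
  qed
  ultimately show ?thesis using walk by blast
qed

text \<open>As long as a cycle of length at least 3 remains, one of its edges can be deleted without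
  losing connectedness.\<close>

lemma undirected_spanning_tree_exists:
  assumes "graph G" "Digraph_Component.connected G"
  shows "\<exists>T. undirected_spanning_tree T G"
  using assms
proof (induction "card (arcs G)" arbitrary: G rule: less_induct)
  case less
  interpret graph G by fact
  show ?case
  proof (cases "\<exists>p. cycle p \<and> 3 \<le> length p")
    case False
    then have "undirected_spanning_tree G G"
      using less.prems wf_digraph
      by (auto simp: undirected_spanning_tree_def undirected_tree_def spanning_def
          subgraph_def compatible_def)
    then show ?thesis ..
  next
    case True
    then obtain e p where cyc: "cycle (e # p)" and len: "3 \<le> length (e # p)"
      by (metis cycle_def list.exhaust)
    define X where "X = {(tail G e, head G e), (head G e, tail G e)}"
    let ?H = "del_ends G X"
    have sym: "sym X" by (auto simp: X_def sym_def)
    interpret H: graph ?H using sym by (rule graph_del_ends)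
    have e: "e \<in> arcs G" using cyc by (auto simp: cycle_def awalk_Cons_iff)
    have detour: "(head G e, tail G e) \<in> (arcs_ends ?H)\<^sup>*"
      using cycle_edge_redundant[OF cyc len] by (simp add: X_def)
    then have "(tail G e, head G e) \<in> (arcs_ends ?H)\<^sup>*"
      using sym_rtrancl[OF H.sym_arcs[unfolded symmetric_def]] by (rule symD[rotated])
    with detour have "arcs_ends G \<subseteq> (arcs_ends ?H)\<^sup>*"
      by (auto simp: X_def)
    then have "(arcs_ends G)\<^sup>* \<subseteq> (arcs_ends ?H)\<^sup>*"
      by (rule rtrancl_subset_rtrancl)
    moreover have "tail G e \<in> verts G" using e by simp
    ultimately have "Digraph_Component.connected ?H"
      using less.prems(2) connected_iff_root[of "tail G e"] H.connected_iff_root[of "tail G e"]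
      by auto
    moreover have "card (arcs ?H) < card (arcs G)"
      using e by (intro psubset_card_mono) (auto simp: X_def)
    ultimately obtain T where "undirected_spanning_tree T ?H"
      using less.hyps H.graph_axioms by blast
    then show ?thesis
      using spanning_trans spanning_del_ends[OF sym] unfolding undirected_spanning_tree_def by blast
  qed
qed

section \<open>Edges between a vertex and a set\<close>

definition star_ends :: "'a \<Rightarrow> 'a set \<Rightarrow> ('a \<times> 'a) set" where
  "star_ends v S = {v} \<times> S \<union> S \<times> {v}"

lemma sym_star_ends: "sym (star_ends v S)"
  by (auto simp: star_ends_def sym_def)

lemma (in graph) not_connected_del_star:
  assumes S: "simultaneous_dominating_set G S" and v: "v \<in> verts G - S"
  shows "\<not> Digraph_Component.connected (del_ends G (star_ends v S))"
proof
  let ?H = "del_ends G (star_ends v S)"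
  assume "Digraph_Component.connected ?H"
  then obtain T where T: "undirected_spanning_tree T ?H"
    using undirected_spanning_tree_exists graph_del_ends[OF sym_star_ends] by blast
  then have sub: "spanning T ?H" by (simp add: undirected_spanning_tree_def)
  then have "undirected_spanning_tree T G"
    using T spanning_trans spanning_del_ends[OF sym_star_ends]
    unfolding undirected_spanning_tree_def by blast
  then have "dominating_set T S"
    using S by (simp add: simultaneous_dominating_set_def)
  moreover have "verts T = verts G" using sub by (simp add: spanning_def)
  ultimately obtain u where u: "u \<in> S" "v \<rightarrow>\<^bsub>T\<^esub> u"
    using v unfolding dominating_set_def by blast
  have "arcs_ends T \<subseteq> arcs_ends ?H"
    using sub by (auto simp: spanning_def subgraph_def compatible_def arcs_ends_conv)
  with u show False by (auto simp: star_ends_def)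
qed

text \<open>A connected graph has a vertex, and the empty set dominates none. This supplies the root
  in \<open>S\<close>.\<close>

lemma (in graph) simultaneous_dominating_set_nonempty:
  assumes "Digraph_Component.connected G" "simultaneous_dominating_set G S"
  shows "S \<noteq> {}"
proof -
  obtain T where T: "undirected_spanning_tree T G"
    using undirected_spanning_tree_exists[OF graph_axioms assms(1)] ..
  then have "dominating_set T S"
    using assms(2) by (simp add: simultaneous_dominating_set_def)
  moreover have "verts T = verts G"
    using T by (simp add: undirected_spanning_tree_def spanning_def)
  moreover have "verts G \<noteq> {}"
    using assms(1) by (auto simp: Digraph_Component.connected_def strongly_connected_def mk_symmetric_def)
  ultimately show ?thesis by (auto simp: dominating_set_def)
qed

section \<open>Reachability avoiding a vertex\<close>

definition reach_avoiding :: "('a, 'b) pre_digraph \<Rightarrow> 'a \<Rightarrow> 'a \<Rightarrow> 'a set" where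
  "reach_avoiding G r v = {x. (r, x) \<in> {(a, b). a \<rightarrow>\<^bsub>G\<^esub> b \<and> a \<noteq> v \<and> b \<noteq> v}\<^sup>*}"

text \<open>This includes \<open>v = r\<close>, where the set is just \<open>{r}\<close>.\<close>

lemma reach_avoiding_refl: "r \<in> reach_avoiding G r v"
  by (simp add: reach_avoiding_def)

lemma reach_avoiding_step:
  assumes "x \<in> reach_avoiding G r v" "x \<rightarrow>\<^bsub>G\<^esub> y" "x \<noteq> v" "y \<noteq> v"
  shows "y \<in> reach_avoiding G r v"
proof -
  have "(x, y) \<in> {(a, b). a \<rightarrow>\<^bsub>G\<^esub> b \<and> a \<noteq> v \<and> b \<noteq> v}" using assms by simp
  with assms(1) show ?thesis unfolding reach_avoiding_def by (blast intro: rtrancl_into_rtrancl)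
qed

lemma reach_first_of_two:
  assumes "(r, v) \<in> (arcs_ends G)\<^sup>*" "r \<noteq> v" "r \<noteq> w" "v \<noteq> w"
  shows "v \<in> reach_avoiding G r w \<or> w \<in> reach_avoiding G r v"
proof -
  \<comment> \<open>Invariant along a walk from \<open>r\<close>: either neither vertex has been
    met, or the first one met was reached without the other.\<close>
  have "(x \<noteq> v \<and> x \<noteq> w \<and> x \<in> reach_avoiding G r v \<and> x \<in> reach_avoiding G r w)
      \<or> v \<in> reach_avoiding G r w \<or> w \<in> reach_avoiding G r v"
    if "(r, x) \<in> (arcs_ends G)\<^sup>*" for x
    using that
  proof (induction rule: rtrancl_induct)
    case base
    show ?case using assms reach_avoiding_refl by metis
  next
    case (step x y)
    then show ?case using assms(4) reach_avoiding_step by metis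
  qed
  from this[OF assms(1)] show ?thesis by blast
qed

text \<open>Walks avoiding \<open>v\<close> lose no edge, so all neighbours of \<open>v\<close> in
  \<open>S\<close> stay reachable, and \<open>v\<close> itself is still reached through
  \<open>w\<close>.\<close>

lemma (in graph) connected_del_star:
  assumes conn: "Digraph_Component.connected G" and r: "r \<in> verts G" "r \<noteq> v"
    and S: "\<And>s. s \<in> S \<Longrightarrow> v \<rightarrow> s \<Longrightarrow> s \<in> reach_avoiding G r v"
    and w: "v \<rightarrow> w" "w \<in> reach_avoiding G r v" "w \<notin> S" and v: "v \<notin> S"
  shows "Digraph_Component.connected (del_ends G (star_ends v S))"
proof -
  let ?H = "del_ends G (star_ends v S)"
  interpret H: graph ?H by (rule graph_del_ends[OF sym_star_ends])
  have avoid: "(r, x) \<in> (arcs_ends ?H)\<^sup>*" if "x \<in> reach_avoiding G r v" for x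
  proof -
    have "{(a, b). a \<rightarrow> b \<and> a \<noteq> v \<and> b \<noteq> v} \<subseteq> arcs_ends ?H"
      by (auto simp: star_ends_def)
    from rtrancl_mono[OF this] that show ?thesis
      unfolding reach_avoiding_def by blast
  qed
  have "(w, v) \<in> arcs_ends ?H"
    using w v graph_symmetric by (auto simp: star_ends_def)
  then have rv: "(r, v) \<in> (arcs_ends ?H)\<^sup>*"
    using avoid[OF w(2)] by (rule rtrancl_into_rtrancl[rotated])
  have "(r, x) \<in> (arcs_ends ?H)\<^sup>*" if "(r, x) \<in> (arcs_ends G)\<^sup>*" for x
    using that
  proof (induction rule: rtrancl_induct)
    case base
    show ?case by simp
  next
    case (step x y)
    \<comment> \<open>A deleted edge either enters \<open>v\<close> or leads from \<open>v\<close>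
      into \<open>S\<close>.\<close>
    consider "y = v" | "x = v" "y \<in> S" | "(x, y) \<in> arcs_ends ?H"
      using step.hyps v by (auto simp: star_ends_def)
    then show ?case
    proof cases
      case 1
      then show ?thesis using rv by simp
    next
      case 2
      then show ?thesis using avoid S step.hyps by blast
    next
      case 3
      with step.IH show ?thesis by (rule rtrancl_into_rtrancl)
    qed
  qed
  then show ?thesis
    using conn r connected_iff_root[of r] H.connected_iff_root[of r] by simp
qed

section \<open>Construction and size of the cover\<close>

lemma (in graph) vertex_cover_of_simultaneous_dominating_set:
  assumes conn: "Digraph_Component.connected G" and S: "simultaneous_dominating_set G S"
  shows "\<exists>C. vertex_cover G C \<and> S \<subseteq> C \<and> card (C - S) < card S"
proof -
  have sub: "S \<subseteq> verts G" using S by (simp add: simultaneous_dominating_set_def)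
  then have fin: "finite S" by (rule finite_subset) simp
  obtain r where r: "r \<in> S" using simultaneous_dominating_set_nonempty[OF conn S] by blast
  have reach: "(r, x) \<in> (arcs_ends G)\<^sup>*" if "x \<in> verts G" for x
    using conn connected_iff_root[of r] r sub that by blast
  define Q where
    "Q = {v \<in> verts G - S. \<exists>s\<in>S. v \<rightarrow> s \<and> s \<notin> reach_avoiding G r v}"
  have first: "v \<in> reach_avoiding G r w \<or> w \<in> reach_avoiding G r v"
    if "v \<in> verts G - S" "w \<in> verts G - S" "v \<noteq> w" for v w
    using that r reach by (intro reach_first_of_two) auto
  have "vertex_cover G (S \<union> Q)"
  proof -
    \<comment> \<open>Since \<open>v\<close> is not in \<open>Q\<close>, its neighbours in
      \<open>S\<close> are reachable without it; a reachable neighbour \<open>w\<close> outside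
      \<open>S\<close> would keep the graph connected after the deletion.\<close>
    have closed: "w \<in> S" if "v \<in> verts G" "v \<notin> S \<union> Q" "v \<rightarrow> w" "w \<in> reach_avoiding G r v" for v w
    proof (rule ccontr)
      assume "w \<notin> S"
      have "Digraph_Component.connected (del_ends G (star_ends v S))"
        using that \<open>w \<notin> S\<close> r sub by (intro connected_del_star[OF conn]) (auto simp: Q_def)
      then show False using not_connected_del_star[OF S] that by blast
    qed
    have "v \<in> S \<union> Q \<or> w \<in> S \<union> Q" if "v \<rightarrow> w" for v w
    proof (rule ccontr)
      assume neg: "\<not> ?thesis"
      have "v \<in> verts G" "w \<in> verts G" "w \<rightarrow> v" "v \<noteq> w"
        using that adj_in_verts graph_symmetric adj_not_same by blast+
      \<comment> \<open>By \<open>first\<close>, one endpoint is reachable avoiding the other, so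
        \<open>closed\<close> puts it into \<open>S\<close>.\<close>
      then show False using neg that first[of v w] closed by blast
    qed
    then show ?thesis
      using sub unfolding vertex_cover_def Q_def arcs_ends_conv by blast
  qed
  moreover have "card Q \<le> card (S - {r})"
  proof -
    have "\<forall>v\<in>Q. \<exists>s. s \<in> S \<and> v \<rightarrow> s \<and> s \<notin> reach_avoiding G r v" by (auto simp: Q_def)
    then obtain g where g: "\<And>v. v \<in> Q \<Longrightarrow> g v \<in> S \<and> v \<rightarrow> g v \<and> g v \<notin> reach_avoiding G r v"
      by metis
    have Q: "v \<in> verts G - S" if "v \<in> Q" for v using that by (simp add: Q_def)
    \<comment> \<open>If \<open>v\<close> is reached avoiding \<open>w\<close>, one more step
      reaches the common value \<open>g v = g w\<close> avoiding \<open>w\<close>, against the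
      choice of \<open>g w\<close>; likewise with the roles exchanged.\<close>
    have "inj_on g Q"
    proof (rule inj_onI, rule ccontr)
      fix v w assume vw: "v \<in> Q" "w \<in> Q" "g v = g w" "v \<noteq> w"
      then have "v \<in> reach_avoiding G r w \<or> w \<in> reach_avoiding G r v"
        using first Q by blast
      moreover have "v \<rightarrow> g v" "w \<rightarrow> g v" "g v \<in> S"
        using g[OF vw(1)] g[OF vw(2)] vw(3) by simp_all
      moreover have "s \<noteq> x" if "s \<in> S" "x \<in> Q" for s x
        using that Q by blast
      ultimately have "g v \<in> reach_avoiding G r w \<or> g v \<in> reach_avoiding G r v"
        using vw(1,2,4) reach_avoiding_step[of v G r w "g v"] reach_avoiding_step[of w G r v "g v"]
        by blast
      then show False using g[OF vw(1)] g[OF vw(2)] vw(3) by simp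
    qed
    \<comment> \<open>The root is never separated from itself; losing it as a value of
      \<open>g\<close> gives the strict bound.\<close>
    moreover have "g v \<in> S - {r}" if "v \<in> Q" for v
      using g[OF that] reach_avoiding_refl[of r G v] by auto
    then have "g ` Q \<subseteq> S - {r}" by (rule image_subsetI)
    ultimately show ?thesis using fin by (intro card_inj_on_le) auto
  qed
  then have "card Q < card S"
    using card_Diff1_less[OF fin r] by simp
  moreover have "(S \<union> Q) - S = Q" by (auto simp: Q_def)
  ultimately show ?thesis by (intro exI[of _ "S \<union> Q"]) auto
qed

theorem theorem5:
  fixes G :: "('a, 'b) pre_digraph"
  assumes "graph G" and "Digraph_Component.connected G"
  shows "(\<forall>S. simultaneous_dominating_set G S \<longrightarrow>
            (\<exists>C. vertex_cover G C \<and> S \<subseteq> C \<and> int (card (C - S)) \<le> int (card S) - 1))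
       \<and> (\<forall>C' S'. is_arg_min card (vertex_cover G) C' \<longrightarrow>
            is_arg_min card (simultaneous_dominating_set G) S' \<longrightarrow>
            int (card C') \<le> 2 * int (card S') - 1)"
proof -
  interpret graph G by fact
  note cover = vertex_cover_of_simultaneous_dominating_set[OF assms(2)]
  have "int (card C') \<le> 2 * int (card S') - 1"
    if C': "is_arg_min card (vertex_cover G) C'"
      and S': "is_arg_min card (simultaneous_dominating_set G) S'" for C' S'
  proof -
    \<comment> \<open>The cover \<open>C\<close> extending \<open>S'\<close> has at most
      \<open>2 * card S' - 1\<close> elements and bounds the minimum cover
      \<open>C'\<close>.\<close>
    obtain C where C: "vertex_cover G C" "S' \<subseteq> C" "card (C - S') < card S'"
      using cover[of S'] S' unfolding is_arg_min_def by blast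
    have "finite C"
      using C(1) finite_subset[OF _ finite_verts] by (simp add: vertex_cover_def)
    then have "card C = card S' + card (C - S')"
      using C(2) by (metis card_Diff_subset card_mono finite_subset le_add_diff_inverse)
    moreover have "card C' \<le> card C"
      using C' C(1) by (auto simp: is_arg_min_def not_less)
    ultimately show ?thesis using C(3) by simp
  qed
  moreover have "\<exists>C. vertex_cover G C \<and> S \<subseteq> C \<and> int (card (C - S)) \<le> int (card S) - 1"
    if "simultaneous_dominating_set G S" for S
    using cover[OF that] by force
  ultimately show ?thesis by blast
qed

end
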